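(* Let $n \ge d$ be positive integers, and let \[ \mathbb{R}^d = V_0 \oplus V_1 \oplus \dots \oplus V_{n-d} \] be an orthogonal decomposition such that $V_1, \dots, V_{n-d}$ have positive even dimensions, with $V_0$ possibly zero dimensional. If $v_1, \dots, v_n$ consist of an orthonormal basis of $V_0$ together with, for each $i \in \{1, \dots, n-d\}$, the vertices of a centered regular simplex inscribed in the unit sphere of $V_i$, then \[ \lVert \varepsilon_1 v_1 + \dots + \varepsilon_n v_n \rVert \le \sqrt{2n-d} \quad \text{for every } \varepsilon_1, \dots, \varepsilon_n \in \{\pm 1\}. \]
   Context: $\lVert\cdot\rVert$ denotes the Euclidean norm on $\mathbb{R}^d$. A centered regular simplex inscribed in the unit sphere of a $k$-dimensional subspace $V$ is a full-dimensional regular simplex in $V$: it has $k+1$ vertices, all of which are unit vectors in $V$, and its center is the origin (equivalently, distinct vertices have inner product $-1/k$). When $n=d$, there are no subspaces $V_i$ with $i\ge 1$ and $V_0=\mathbb{R}^d$. *)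

theory Defs
  imports "HOL-Analysis.Analysis"
begin

definition orthogonal_decomposition :: "nat \<Rightarrow> (nat \<Rightarrow> 'a::euclidean_space set) \<Rightarrow> bool" where
  "orthogonal_decomposition m V \<longleftrightarrow>
     (\<forall>i\<le>m. subspace (V i)) \<and>
     (\<forall>i\<le>m. \<forall>j\<le>m. i \<noteq> j \<longrightarrow> (\<forall>x\<in>V i. \<forall>y\<in>V j. orthogonal x y)) \<and>
     span (\<Union>i\<le>m. V i) = UNIV"

definition orthonormal_basis :: "'a::euclidean_space set \<Rightarrow> 'a set \<Rightarrow> bool" where
  "orthonormal_basis V B \<longleftrightarrow>
     independent B \<and> span B = V \<and> pairwise orthogonal B \<and> (\<forall>x\<in>B. norm x = 1)"

text \<open>\<open>S\<close> is the vertex set of a full-dimensional regular simplex in the subspace \<open>V\<close>,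
  inscribed in the unit sphere of \<open>V\<close> and with its centroid at the origin.\<close>

definition centered_regular_simplex :: "'a::euclidean_space set \<Rightarrow> 'a set \<Rightarrow> bool" where
  "centered_regular_simplex V S \<longleftrightarrow>
     S \<subseteq> V \<and> card S = dim V + 1 \<and> \<not> affine_dependent S \<and>
     (\<exists>l. \<forall>x\<in>S. \<forall>y\<in>S. x \<noteq> y \<longrightarrow> dist x y = l) \<and>
     (\<forall>x\<in>S. norm x = 1) \<and>
     (\<Sum>x\<in>S. x) /\<^sub>R real (card S) = 0"

end

theory Submission
  imports Defs
begin

text \<open>
  The signed sum splits into mutually orthogonal parts, one for \<open>V\<^sub>0\<close> and one for each simplex, so
  the squared norms of the parts add up. The part in \<open>V\<^sub>0\<close> contributes exactly \<open>dim V\<^sub>0\<close>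
  (\<open>norm_signed_sum_orthonormal\<close>).

  In a simplex with \<open>k + 1\<close> vertices the Gram matrix is \<open>(1 + 1/k) I - (1/k) J\<close>, with \<open>J\<close> the all-ones
  matrix, so signs \<open>e\<close> give the squared norm \<open>((k + 1)\<^sup>2 - (\<Sum>e)\<^sup>2) / k\<close>. This is where the parity of the
  dimension enters: for even \<open>k\<close> an odd number of signs is added, hence \<open>(\<Sum>e)\<^sup>2 \<ge> 1\<close> and
  the squared norm is at most \<open>((k + 1)\<^sup>2 - 1) / k = k + 2\<close> (\<open>norm_signed_sum_simplex_le\<close>).

  Each simplex has one vertex more than the dimension of its subspace. Its bound \<open>k + 2\<close> is thus its
  number of vertices plus one, and the bounds add up to \<open>n + (n - d) = 2n - d\<close>. Here \<open>n\<close> enters as the number of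
  vectors, the blocks being disjoint because orthogonal unit vectors are distinct.
\<close>

text \<open>The Gram matrix of an equiangular system is \<open>(1 - c) I + c J\<close>, with \<open>J\<close> the all-ones
  matrix; this is its quadratic form.\<close>

lemma norm_signed_sum_equiangular:
  fixes S :: "'a::real_inner set" and a :: "'a \<Rightarrow> real"
  assumes fin: "finite S"
    and unit: "\<And>x. x \<in> S \<Longrightarrow> norm x = 1"
    and ang: "\<And>x y. x \<in> S \<Longrightarrow> y \<in> S \<Longrightarrow> x \<noteq> y \<Longrightarrow> x \<bullet> y = c"
  shows "(norm (\<Sum>x\<in>S. a x *\<^sub>R x))\<^sup>2 = (1 - c) * (\<Sum>x\<in>S. (a x)\<^sup>2) + c * (\<Sum>x\<in>S. a x)\<^sup>2"
proof -
  have gram: "x \<bullet> y = (if x = y then 1 - c else 0) + c" if "x \<in> S" "y \<in> S" for x y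
    using unit[OF that(1)] ang[OF that] by (auto simp: norm_eq_1)
  have "(norm (\<Sum>x\<in>S. a x *\<^sub>R x))\<^sup>2 = (\<Sum>x\<in>S. \<Sum>y\<in>S. a x * (a y * (x \<bullet> y)))"
    by (simp add: power2_norm_eq_inner inner_sum_left inner_sum_right)
       (simp add: sum_distrib_left inner_commute)
  also have "\<dots> = (\<Sum>x\<in>S. \<Sum>y\<in>S. (if x = y then (1 - c) * (a x)\<^sup>2 else 0) + c * (a x * a y))"
    by (intro sum.cong refl) (auto simp: gram power2_eq_square algebra_simps)
  also have "\<dots> = (1 - c) * (\<Sum>x\<in>S. (a x)\<^sup>2) + c * (\<Sum>x\<in>S. a x)\<^sup>2"
    using fin
    by (simp add: sum.distrib sum.delta power2_eq_square[of "sum a S"] sum_product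
          flip: sum_distrib_left)
  finally show ?thesis .
qed

lemma sum_signs_parity:
  fixes e :: "'a \<Rightarrow> real"
  assumes "finite S" and "\<And>x. x \<in> S \<Longrightarrow> e x \<in> {1, -1}"
  shows "\<exists>k::int. (\<Sum>x\<in>S. e x) = of_int k \<and> (even k \<longleftrightarrow> even (card S))"
  using assms
proof (induction S rule: finite_induct)
  case empty
  show ?case by (intro exI[of _ 0]) simp
next
  case (insert x S)
  then obtain k :: int where k: "(\<Sum>x\<in>S. e x) = of_int k" "even k \<longleftrightarrow> even (card S)"
    by auto
  have "e x = 1 \<or> e x = -1" using insert.prems[of x] by simp
  then show ?case
  proof
    assume "e x = 1"
    then show ?thesis using k insert.hyps by (intro exI[of _ "1 + k"]) simp
  next
    assume "e x = -1"
    then show ?thesis using k insert.hyps by (intro exI[of _ "k - 1"]) simp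
  qed
qed

lemma sum_odd_signs_square_ge_1:
  fixes e :: "'a \<Rightarrow> real"
  assumes "odd (card S)" and "\<And>x. x \<in> S \<Longrightarrow> e x \<in> {1, -1}"
  shows "1 \<le> (\<Sum>x\<in>S. e x)\<^sup>2"
proof -
  have "finite S" using assms(1) by (cases "finite S") auto
  then obtain k :: int where k: "(\<Sum>x\<in>S. e x) = of_int k" "odd k"
    using sum_signs_parity[of S e] assms by auto
  then have "k \<noteq> 0" by auto
  then have "1 \<le> k\<^sup>2" by (simp add: int_one_le_iff_zero_less)
  then have "1 \<le> (of_int (k\<^sup>2) :: real)" by linarith
  then show ?thesis using k by simp
qed

text \<open>Equal distances between unit vectors mean equal inner products. Their common value is determined
  by the vanishing of the centroid: the quadratic form above is zero at the all-ones vector.\<close>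

lemma centered_regular_simplex_inner:
  fixes S :: "'a::euclidean_space set"
  assumes simp: "centered_regular_simplex V S" and dim: "0 < dim V"
    and xy: "x \<in> S" "y \<in> S" "x \<noteq> y"
  shows "x \<bullet> y = - 1 / real (dim V)"
proof -
  define k where "k = real (dim V)"
  have k0: "0 < k" using dim by (simp add: k_def)
  have card: "card S = dim V + 1" and unit: "\<And>x. x \<in> S \<Longrightarrow> norm x = 1"
    using simp by (auto simp: centered_regular_simplex_def)
  have fin: "finite S" using card by (intro card_ge_0_finite) simp
  have centroid: "(\<Sum>x\<in>S. x) = 0"
    using simp card by (simp add: centered_regular_simplex_def)
  obtain l where l: "\<And>x y. x \<in> S \<Longrightarrow> y \<in> S \<Longrightarrow> x \<noteq> y \<Longrightarrow> dist x y = l"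
    using simp by (auto simp: centered_regular_simplex_def)
  define c where "c = 1 - l\<^sup>2 / 2"
  have ang: "x \<bullet> y = c" if "x \<in> S" "y \<in> S" "x \<noteq> y" for x y
  proof -
    have "l\<^sup>2 = (norm (x - y))\<^sup>2" using l[OF that] by (simp add: dist_norm)
    also have "\<dots> = (norm x)\<^sup>2 + (norm y)\<^sup>2 - 2 * (x \<bullet> y)"
      by (simp add: power2_norm_eq_inner inner_diff_left inner_diff_right inner_commute)
    finally show ?thesis using unit that by (simp add: c_def field_simps)
  qed
  have "0 = (1 - c) * (k + 1) + c * (k + 1)\<^sup>2"
    using norm_signed_sum_equiangular[OF fin unit ang, of "\<lambda>_. 1"] centroid card
    by (simp add: k_def add.commute)
  also have "\<dots> = (k + 1) * (1 + c * k)" by (simp add: algebra_simps power2_eq_square)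
  finally have "1 + c * k = 0" using k0 by simp
  then have "c = - 1 / k" using k0 by (simp add: field_simps)
  then show ?thesis using ang[OF xy] by (simp add: k_def)
qed

text \<open>The quadratic form decreases in \<open>(\<Sum>e)\<^sup>2\<close>, because simplex vertices have negative inner
  products. The worst signs are thus the most balanced ones, and on an odd number of vertices their
  sum is still \<open>\<plusminus>1\<close>.\<close>

lemma norm_signed_sum_simplex_le:
  fixes S :: "'a::euclidean_space set"
  assumes simp: "centered_regular_simplex V S" and dim: "0 < dim V" "even (dim V)"
    and e: "\<And>x. x \<in> S \<Longrightarrow> e x \<in> {1, -1}"
  shows "(norm (\<Sum>x\<in>S. e x *\<^sub>R x))\<^sup>2 \<le> real (card S) + 1"
proof -
  define k where "k = real (dim V)"
  have k0: "0 < k" using dim by (simp add: k_def)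
  have card: "card S = dim V + 1" and unit: "\<And>x. x \<in> S \<Longrightarrow> norm x = 1"
    using simp by (auto simp: centered_regular_simplex_def)
  have fin: "finite S" using card by (intro card_ge_0_finite) simp
  have squares: "(\<Sum>x\<in>S. (e x)\<^sup>2) = k + 1"
  proof -
    have "(\<Sum>x\<in>S. (e x)\<^sup>2) = (\<Sum>x\<in>S. 1)" using e by (intro sum.cong refl) force
    then show ?thesis using card by (simp add: k_def)
  qed
  have ge1: "1 \<le> (\<Sum>x\<in>S. e x)\<^sup>2"
    using card dim e by (intro sum_odd_signs_square_ge_1) auto
  have "(norm (\<Sum>x\<in>S. e x *\<^sub>R x))\<^sup>2 = (1 + 1 / k) * (k + 1) - (\<Sum>x\<in>S. e x)\<^sup>2 / k"
    using norm_signed_sum_equiangular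
        [OF fin unit centered_regular_simplex_inner[OF simp dim(1)], of e] squares
    by (simp add: k_def)
  also have "\<dots> \<le> (1 + 1 / k) * (k + 1) - 1 / k"
    using ge1 k0 by (simp add: divide_right_mono)
  also have "\<dots> = k + 2" using k0 by (simp add: field_simps)
  finally show ?thesis using card by (simp add: k_def)
qed

lemma norm_signed_sum_orthonormal:
  fixes B :: "'a::euclidean_space set"
  assumes B: "orthonormal_basis V B" and e: "\<And>x. x \<in> B \<Longrightarrow> e x \<in> {1, -1}"
  shows "(norm (\<Sum>x\<in>B. e x *\<^sub>R x))\<^sup>2 = real (card B)"
proof -
  have fin: "finite B" and unit: "\<And>x. x \<in> B \<Longrightarrow> norm x = 1"
    and orth: "\<And>x y. x \<in> B \<Longrightarrow> y \<in> B \<Longrightarrow> x \<noteq> y \<Longrightarrow> x \<bullet> y = 0"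
    using B by (auto simp: orthonormal_basis_def independent_imp_finite pairwise_def orthogonal_def)
  have "(\<Sum>x\<in>B. (e x)\<^sup>2) = (\<Sum>x\<in>B. 1)" using e by (intro sum.cong refl) force
  then show ?thesis using norm_signed_sum_equiangular[OF fin unit orth, of e] by simp
qed

theorem proposition2:
  fixes n :: nat
    and V :: "nat \<Rightarrow> (real ^ 'd) set"
    and B :: "(real ^ 'd) set"
    and S :: "nat \<Rightarrow> (real ^ 'd) set"
    and v :: "nat \<Rightarrow> real ^ 'd"
    and \<epsilon> :: "nat \<Rightarrow> real"
  assumes "CARD('d) \<le> n"
    and "orthogonal_decomposition (n - CARD('d)) V"
    and "\<And>i. i \<in> {1..n - CARD('d)} \<Longrightarrow> 0 < dim (V i) \<and> even (dim (V i))"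
    and "orthonormal_basis (V 0) B"
    and "\<And>i. i \<in> {1..n - CARD('d)} \<Longrightarrow> centered_regular_simplex (V i) (S i)"
    and "bij_betw v {1..n} (B \<union> (\<Union>i\<in>{1..n - CARD('d)}. S i))"
    and "\<And>i. i \<in> {1..n} \<Longrightarrow> \<epsilon> i \<in> {1, -1}"
  shows "norm (\<Sum>i=1..n. \<epsilon> i *\<^sub>R v i) \<le> sqrt (2 * real n - real CARD('d))"
proof -
  define m where "m = n - CARD('d)"
  \<comment> \<open>Treating the basis of \<open>V 0\<close> as block 0 makes the orthogonality of the blocks uniform.\<close>
  define P where "P i = (if i = 0 then B else S i)" for i
  define U where "U = (\<Union>i\<in>{..m}. P i)"
  define e where "e x = \<epsilon> (inv_into {1..n} v x)" for x

  have indices: "{..m} = insert 0 {1..m}" by auto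
  have P_S: "P i = S i" if "i \<in> {1..m}" for i using that by (simp add: P_def)
  have simplex: "centered_regular_simplex (V i) (P i)" "0 < dim (V i)" "even (dim (V i))"
    if "i \<in> {1..m}" for i
    using assms(3,5) that P_S[OF that] by (auto simp: m_def)
  have P_0: "P 0 = B" by (simp add: P_def)
  have U_eq: "U = B \<union> (\<Union>i\<in>{1..n - CARD('d)}. S i)"
    unfolding U_def indices using P_S P_0 by (simp add: m_def)
  have bij: "bij_betw v {1..n} U" using assms(6) U_eq by simp

  have P_props: "finite (P i)" "P i \<subseteq> V i" "\<And>x. x \<in> P i \<Longrightarrow> norm x = 1" if "i \<le> m" for i
  proof -
    have "finite (P i) \<and> P i \<subseteq> V i \<and> (\<forall>x\<in>P i. norm x = 1)"
    proof (cases "i = 0")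
      case True
      then show ?thesis
        using assms(4) by (auto simp: P_0 orthonormal_basis_def independent_imp_finite intro: span_base)
    next
      case False
      with that have "centered_regular_simplex (V i) (P i)" by (intro simplex) simp
      then show ?thesis
        by (auto simp: centered_regular_simplex_def intro: card_ge_0_finite)
    qed
    then show "finite (P i)" "P i \<subseteq> V i" "\<And>x. x \<in> P i \<Longrightarrow> norm x = 1" by auto
  qed
  have orth: "orthogonal x y" if "i \<le> m" "j \<le> m" "i \<noteq> j" "x \<in> P i" "y \<in> P j" for i j x y
    using assms(2) that P_props(2)[of i] P_props(2)[of j]
    unfolding orthogonal_decomposition_def m_def by blast
  have disj: "P i \<inter> P j = {}" if "i \<le> m" "j \<le> m" "i \<noteq> j" for i j
  proof (rule ccontr)
    assume "P i \<inter> P j \<noteq> {}"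
    then obtain x where "x \<in> P i" "x \<in> P j" by blast
    then have "orthogonal x x" "norm x = 1" using orth[OF that] P_props(3)[OF that(1)] by auto
    then show False by (auto simp: orthogonal_self)
  qed
  have sign: "e x \<in> {1, -1}" if "x \<in> P i" "i \<le> m" for x i
  proof -
    have "x \<in> v ` {1..n}" using bij that by (auto simp: bij_betw_def U_def)
    then show ?thesis unfolding e_def by (intro assms(7) inv_into_into)
  qed

  have sum_eq: "(\<Sum>i=1..n. \<epsilon> i *\<^sub>R v i) = (\<Sum>i\<le>m. \<Sum>x\<in>P i. e x *\<^sub>R x)"
  proof -
    have "(\<Sum>i=1..n. \<epsilon> i *\<^sub>R v i) = (\<Sum>i=1..n. e (v i) *\<^sub>R v i)"
      using bij by (intro sum.cong refl) (simp add: e_def bij_betw_def inv_into_f_f)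
    also have "\<dots> = (\<Sum>x\<in>U. e x *\<^sub>R x)" by (rule sum.reindex_bij_betw[OF bij])
    also have "\<dots> = (\<Sum>i\<le>m. \<Sum>x\<in>P i. e x *\<^sub>R x)"
      unfolding U_def using P_props(1) disj by (intro sum.UNION_disjoint) auto
    finally show ?thesis .
  qed
  have count: "(\<Sum>i\<le>m. card (P i)) = n"
  proof -
    have "n = card U" using bij_betw_same_card[OF bij] by simp
    also have "\<dots> = (\<Sum>i\<le>m. card (P i))"
      unfolding U_def using P_props(1) disj by (intro card_UN_disjoint) auto
    finally show ?thesis by simp
  qed

  have orth_sums: "orthogonal (\<Sum>x\<in>P i. e x *\<^sub>R x) (\<Sum>x\<in>P j. e x *\<^sub>R x)"
    if "i \<le> m" "j \<le> m" "i \<noteq> j" for i j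
    using orth[OF that]
    by (simp add: orthogonal_def inner_sum_left inner_sum_right)
  have "(norm (\<Sum>i=1..n. \<epsilon> i *\<^sub>R v i))\<^sup>2 = (\<Sum>i\<le>m. (norm (\<Sum>x\<in>P i. e x *\<^sub>R x))\<^sup>2)"
    unfolding sum_eq
    by (intro norm_sum_Pythagorean finite_atMost pairwiseI orth_sums) auto
  \<comment> \<open>Block 0 stays within its number of vectors; each simplex exceeds its own by at most one.\<close>
  also have "\<dots> \<le> (\<Sum>i\<le>m. real (card (P i)) + (if i = 0 then 0 else 1))"
  proof (rule sum_mono)
    fix i assume i: "i \<in> {..m}"
    show "(norm (\<Sum>x\<in>P i. e x *\<^sub>R x))\<^sup>2 \<le> real (card (P i)) + (if i = 0 then 0 else 1)"
    proof (cases "i = 0")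
      case True
      then show ?thesis
        using norm_signed_sum_orthonormal[OF assms(4), of e] sign[of _ 0] by (simp add: P_0)
    next
      case False
      with i have "i \<in> {1..m}" by simp
      then show ?thesis
        using norm_signed_sum_simplex_le[OF simplex, of i e] sign[of _ i] False i by auto
    qed
  qed
  also have "\<dots> = real n + real m"
    using count by (simp add: sum.distrib indices flip: of_nat_sum)
  also have "\<dots> = 2 * real n - real CARD('d)" using assms(1) by (simp add: m_def of_nat_diff)
  finally show ?thesis by (rule real_le_rsqrt)
qed

end
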